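(* Let $\theta\in\mathbb R$ be such that $\tan\theta\notin\mathbb Q\cup\{\infty\}$. Let $g(t)=\left(t\cos\theta,\ t\sin\theta,\ \frac{t^2}{2}\sin\theta\cos\theta\right)\in G$ (in the coordinates $(a,b,c)$) and $g'(t)=\pi(g(t))\in M$, $t\in\mathbb R$. Then the curve $\Gamma=\{g'(t)\mid t\in\mathbb R\}$ is dense in $M$. Moreover, each of its halves $\Gamma_+=\{g'(t)\mid t\in\mathbb R_+\}$ and $\Gamma_-=\{g'(t)\mid t\in\mathbb R_-\}$ is dense in $M$.
   Context: $G$ is the 3D Heisenberg group of real unipotent upper triangular matrices $\begin{pmatrix}1&a&c\\0&1&b\\0&0&1\end{pmatrix}$, identified with $\mathbb R^3$ via the coordinates $(a,b,c)$, so that $(a,b,c)\cdot(\bar a,\bar b,\bar c)=(a+\bar a,\,b+\bar b,\,c+\bar c+a\bar b)$. $H\subset G$ is the discrete subgroup of elements with $a,b,c\in\mathbb Z$. $M=H\backslash G=\{Hg\mid g\in G\}$ is the (compact) Heisenberg 3D nil-manifold with the quotient topology and $\pi:G\to M$, $g\mapsto Hg$, is the projection. $\tan\theta=\infty$ means $\cos\theta=0$. *)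

theory Defs
  imports "HOL-Analysis.Analysis" "HOL-Algebra.Coset"
begin

definition heis :: "real \<Rightarrow> real \<Rightarrow> real \<Rightarrow> real ^ 3 ^ 3" where
  "heis a b c = vector [vector [1, a, c],
                        vector [0, 1, b],
                        vector [0, 0, 1]]"

definition heis_group :: "(real ^ 3 ^ 3) monoid" where
  "heis_group = \<lparr>carrier = {heis a b c | a b c. True}, mult = (**), one = mat 1\<rparr>"

definition heis_int :: "(real ^ 3 ^ 3) set" where
  "heis_int = {heis a b c | a b c. a \<in> \<int> \<and> b \<in> \<int> \<and> c \<in> \<int>}"

lemma heis_mult: "heis a b c ** heis a' b' c' = heis (a + a') (b + b') (c + c' + a * b')"
  by (simp add: heis_def vec_eq_iff matrix_matrix_mult_def sum_3 forall_3 algebra_simps)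

lemma heis_inject [simp]: "heis a b c = heis a' b' c' \<longleftrightarrow> a = a' \<and> b = b' \<and> c = c'"
  by (auto simp: heis_def vec_eq_iff forall_3)

lemma heis_zero: "heis 0 0 0 = mat 1"
  by (simp add: heis_def vec_eq_iff forall_3 mat_def)

lemma group_heis_group: "group heis_group"
proof (rule groupI)
  fix x assume "x \<in> carrier heis_group"
  then obtain a b c where x: "x = heis a b c"
    by (auto simp: heis_group_def)
  have "heis (- a) (- b) (a * b - c) ** x = mat 1"
    by (simp add: x heis_mult flip: heis_zero)
  then show "\<exists>y\<in>carrier heis_group. y \<otimes>\<^bsub>heis_group\<^esub> x = \<one>\<^bsub>heis_group\<^esub>"
    by (auto simp: heis_group_def)
qed (auto simp: heis_group_def heis_mult matrix_mul_assoc simp flip: heis_zero)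

lemma subgroup_heis_int: "subgroup heis_int heis_group"
proof -
  interpret group heis_group
    by (rule group_heis_group)
  show ?thesis
  proof (rule subgroupI)
    show "heis_int \<noteq> {}"
      unfolding heis_int_def using Ints_0 by blast
  next
    fix x assume "x \<in> heis_int"
    then obtain a b c where x: "x = heis a b c" and abc: "a \<in> \<int>" "b \<in> \<int>" "c \<in> \<int>"
      by (auto simp: heis_int_def)
    have "inv\<^bsub>heis_group\<^esub> x = heis (- a) (- b) (a * b - c)"
      by (rule inv_equality) (auto simp: x heis_group_def heis_mult simp flip: heis_zero)
    then show "inv\<^bsub>heis_group\<^esub> x \<in> heis_int"
      using abc by (auto simp: heis_int_def)
  qed (auto simp: heis_group_def heis_int_def heis_mult)
qed

definition quotient_topology :: "'a topology \<Rightarrow> ('a \<Rightarrow> 'b) \<Rightarrow> 'b topology" where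
  "quotient_topology X f =
     topology (\<lambda>U. U \<subseteq> f ` topspace X \<and> openin X {x \<in> topspace X. f x \<in> U})"

lemma openin_quotient_topology:
  "openin (quotient_topology X f) U \<longleftrightarrow>
     U \<subseteq> f ` topspace X \<and> openin X {x \<in> topspace X. f x \<in> U}"
proof -
  have "istopology (\<lambda>U. U \<subseteq> f ` topspace X \<and> openin X {x \<in> topspace X. f x \<in> U})"
    unfolding istopology_def
  proof (intro conjI allI impI)
    fix S T
    assume S: "S \<subseteq> f ` topspace X \<and> openin X {x \<in> topspace X. f x \<in> S}"
      and T: "T \<subseteq> f ` topspace X \<and> openin X {x \<in> topspace X. f x \<in> T}"
    have "{x \<in> topspace X. f x \<in> S \<inter> T} =
        {x \<in> topspace X. f x \<in> S} \<inter> {x \<in> topspace X. f x \<in> T}"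
      by auto
    then show "openin X {x \<in> topspace X. f x \<in> S \<inter> T}"
      using S T by (simp add: openin_Int)
    show "S \<inter> T \<subseteq> f ` topspace X"
      using S by auto
  next
    fix K
    assume K: "\<forall>S\<in>K. S \<subseteq> f ` topspace X \<and> openin X {x \<in> topspace X. f x \<in> S}"
    have "{x \<in> topspace X. f x \<in> \<Union> K} = (\<Union>S\<in>K. {x \<in> topspace X. f x \<in> S})"
      by auto
    then show "openin X {x \<in> topspace X. f x \<in> \<Union> K}"
      using K by auto
    show "\<Union> K \<subseteq> f ` topspace X"
      using K by auto
  qed
  then show ?thesis
    by (simp add: quotient_topology_def)
qed

lemma topspace_quotient_topology [simp]: "topspace (quotient_topology X f) = f ` topspace X"
proof
  show "topspace (quotient_topology X f) \<subseteq> f ` topspace X"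
    using openin_topspace[of "quotient_topology X f"] unfolding openin_quotient_topology by blast
  have "{x \<in> topspace X. f x \<in> f ` topspace X} = topspace X"
    by auto
  then have "openin (quotient_topology X f) (f ` topspace X)"
    by (simp add: openin_quotient_topology)
  then show "f ` topspace X \<subseteq> topspace (quotient_topology X f)"
    by (rule openin_subset)
qed

lemma quotient_map_quotient_topology: "quotient_map X (quotient_topology X f) f"
  by (auto simp: quotient_map_def openin_quotient_topology)

definition heis_proj :: "real ^ 3 ^ 3 \<Rightarrow> (real ^ 3 ^ 3) set" where
  "heis_proj g = heis_int #>\<^bsub>heis_group\<^esub> g"

text \<open>The Heisenberg group carries the topology induced from the space of matrices, which under
  the coordinates \<open>(a, b, c)\<close> is the usual topology of three-dimensional space.\<close>

definition heis_nilmanifold :: "(real ^ 3 ^ 3) set topology" where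
  "heis_nilmanifold = quotient_topology (top_of_set (carrier heis_group)) heis_proj"

lemma topspace_heis_nilmanifold: "topspace heis_nilmanifold = rcosets\<^bsub>heis_group\<^esub> heis_int"
  by (auto simp: heis_nilmanifold_def heis_proj_def RCOSETS_def)

definition heis_curve :: "real \<Rightarrow> real \<Rightarrow> real ^ 3 ^ 3" where
  "heis_curve \<theta> t = heis (t * cos \<theta>) (t * sin \<theta>) (t\<^sup>2 / 2 * sin \<theta> * cos \<theta>)"

definition nil_curve :: "real \<Rightarrow> real \<Rightarrow> (real ^ 3 ^ 3) set" where
  "nil_curve \<theta> t = heis_proj (heis_curve \<theta> t)"

definition dense_in :: "'a topology \<Rightarrow> 'a set \<Rightarrow> bool" where
  "dense_in X S \<longleftrightarrow> S \<subseteq> topspace X \<and> X closure_of S = topspace X"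

end

theory Submission
  imports Defs "HOL-Library.Real_Mod"
begin

text \<open>
  Put \<open>s = tan \<theta>\<close>, which is irrational. The curve crosses the plane \<open>a = x - m\<close> at the time
  \<open>t = (x - m) / cos \<theta>\<close>, and for an integer \<open>m\<close> the left translation by the integral element
  \<open>(m, n, k)\<close> carries that point to \<open>(x, n + x s - m s, k + (x\<^sup>2 - m\<^sup>2) s / 2)\<close>. So it suffices that the
  pairs \<open>(m s, m\<^sup>2 s / 2)\<close> are dense modulo the integer lattice, where \<open>m\<close> may be restricted to integers
  of large modulus and either sign; the sign of \<open>m\<close> decides the sign of \<open>t\<close>. This is why both
  halves of the curve are already dense (lemmas \<open>nil_curve_return\<close> and \<open>dense_in_nilmanifold_half\<close>).

  The density modulo the lattice is Weyl's theorem for quadratic phases. Differencing turns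
  a quadratic phase into a linear one with irrational slope, whose averages vanish because the sum is
  geometric; van der Corput's lemma transfers this to the quadratic phase
  (\<open>average_expi_quadratic\<close>). Density then follows by testing against the single
  non-negative trigonometric polynomial \<open>(cos\<^sup>2 (\<pi> x) cos\<^sup>2 (\<pi> y))\<^sup>K\<close>. Its average along the orbit is its
  constant Fourier coefficient, the square of \<open>(2K choose K) / 4\<^sup>K\<close>, which decays only like
  a power of \<open>K\<close>. An orbit avoiding a neighbourhood of the peak would make the average exponentially
  small in \<open>K\<close>.
\<close>

section \<open>Averages of bounded sequences\<close>

definition average :: "(nat \<Rightarrow> 'a::real_normed_field) \<Rightarrow> nat \<Rightarrow> 'a" where
  "average f N = (\<Sum>n<N. f n) / of_nat N"

lemma average_of_real: "average (\<lambda>n. of_real (f n)) N = of_real (average f N)"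
  by (simp add: average_def)

lemma average_cnj: "average (\<lambda>n. cnj (f n)) N = cnj (average f N)"
  by (simp add: average_def)

lemma average_sum: "average (\<lambda>n. \<Sum>i\<in>I. f i n) N = (\<Sum>i\<in>I. average (f i) N)"
  unfolding average_def by (subst sum.swap) (simp add: sum_divide_distrib)

lemma average_mult_left: "average (\<lambda>n. c * f n) N = c * average f N"
  by (simp add: average_def sum_distrib_left)

lemma average_divide: "average (\<lambda>n. f n / c) N = average f N / c"
  by (simp add: average_def mult.commute flip: sum_divide_distrib)

lemma average_const: "average (\<lambda>n. c) \<longlonglongrightarrow> c"
proof -
  have "\<forall>\<^sub>F N in sequentially. average (\<lambda>n. c) N = c"
    using eventually_gt_at_top[of 0] by eventually_elim (simp add: average_def)
  then show ?thesis
    by (rule tendsto_eventually)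
qed

text \<open>The two sums share all but \<open>h\<close> terms at either end, so they differ by at most \<open>2 h\<close>.\<close>

lemma average_shift:
  fixes f :: "nat \<Rightarrow> 'a::real_normed_field"
  assumes bound: "\<And>n. norm (f n) \<le> 1"
  shows "(\<lambda>N. average (\<lambda>n. f (n + h)) N - average f N) \<longlonglongrightarrow> 0"
proof -
  have diff: "(\<Sum>n<N. f (n + h)) - (\<Sum>n<N. f n) = (\<Sum>k<h. f (N + k) - f k)" for N
  proof (induction h)
    case (Suc h)
    have "(\<Sum>n<N. f (n + Suc h)) - (\<Sum>n<N. f (n + h)) = f (N + h) - f h"
      using sum_lessThan_telescope[of "\<lambda>n. f (n + h)" N] by (simp add: sum_subtractf)
    with Suc show ?case
      by (simp only: sum.lessThan_Suc) (simp add: algebra_simps)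
  qed simp
  show ?thesis
  proof (rule Lim_null_comparison)
    have "norm (average (\<lambda>n. f (n + h)) N - average f N) \<le> 2 * real h / real N" for N
    proof -
      have "norm (\<Sum>k<h. f (N + k) - f k) \<le> (\<Sum>k<h. 2)"
      proof (rule sum_norm_le)
        show "norm (f (N + k) - f k) \<le> 2" for k
          using norm_triangle_ineq4[of "f (N + k)" "f k"] bound[of "N + k"] bound[of k] by linarith
      qed
      then show ?thesis
        by (simp add: average_def diff norm_divide divide_right_mono mult.commute
            flip: diff_divide_distrib)
    qed
    then show "\<forall>\<^sub>F N in sequentially.
        norm (average (\<lambda>n. f (n + h)) N - average f N) \<le> 2 * real h / real N"
      by simp
    show "(\<lambda>N. 2 * real h / real N) \<longlonglongrightarrow> 0"
      by (rule lim_const_over_n)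
  qed
qed

lemma norm_average_power2_le:
  fixes f :: "nat \<Rightarrow> 'a::real_normed_field"
  shows "(norm (average f N))\<^sup>2 \<le> average (\<lambda>n. (norm (f n))\<^sup>2) N"
proof (cases "N = 0")
  case False
  have "(norm (\<Sum>n<N. f n))\<^sup>2 \<le> (\<Sum>n<N. norm (f n))\<^sup>2"
    by (intro power_mono norm_sum) auto
  also have "\<dots> \<le> (\<Sum>n<N. (norm (f n))\<^sup>2) * real N"
    using sum_squared_le_sum_of_squares[of "\<lambda>n. norm (f n)" "{..<N}"] by simp
  finally show ?thesis
    using False by (simp add: average_def norm_divide power_divide field_simps power2_eq_square)
qed (simp add: average_def)

text \<open>
  Replacing \<open>a\<close> by its moving average \<open>b\<close> over a window of length \<open>H\<close> does not change the limit behaviour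
  of the averages. By Cauchy-Schwarz, the average of \<open>b\<close> is controlled by that of \<open>\<bar>b\<bar>\<^sup>2\<close>; after expanding the
  square only the \<open>H\<close> diagonal terms out of \<open>H\<^sup>2\<close> survive, which leaves \<open>1 / H\<close>.
\<close>

lemma van_der_Corput:
  fixes a :: "nat \<Rightarrow> complex"
  assumes unit: "\<And>n. norm (a n) = 1"
    and corr: "\<And>h. h > 0 \<Longrightarrow> average (\<lambda>n. a (n + h) * cnj (a n)) \<longlonglongrightarrow> 0"
  shows "average a \<longlonglongrightarrow> 0"
proof (rule tendstoI)
  have later: "average (\<lambda>n. a (n + h) * cnj (a (n + k))) \<longlonglongrightarrow> 0" if "k < h" for h k
  proof -
    have "(\<lambda>N. average (\<lambda>n. a (n + k + (h - k)) * cnj (a (n + k))) N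
             - average (\<lambda>n. a (n + (h - k)) * cnj (a n)) N) \<longlonglongrightarrow> 0"
      by (rule average_shift[where f = "\<lambda>n. a (n + (h - k)) * cnj (a n)"])
        (simp add: norm_mult unit)
    from tendsto_add[OF this corr[of "h - k"]] that show ?thesis
      by (simp add: add.assoc)
  qed
  have pair: "average (\<lambda>n. a (n + h) * cnj (a (n + k))) \<longlonglongrightarrow> (if h = k then 1 else 0)" for h k
  proof (cases h k rule: linorder_cases)
    case less
    from tendsto_cnj[OF later[OF less]] less show ?thesis
      by (simp add: mult.commute flip: average_cnj)
  next
    case equal
    have "a n * cnj (a n) = 1" for n
      by (simp add: unit flip: complex_norm_square)
    with equal average_const show ?thesis
      by simp
  next
    case greater
    with later show ?thesis
      by simp
  qed
  fix e :: real
  assume "e > 0"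
  \<comment> \<open>The limit \<open>1 / H\<close> has to lie below \<open>(e / 2)\<^sup>2\<close>, the other \<open>e / 2\<close> being spent on replacing \<open>a\<close> by \<open>b\<close>.\<close>
  then obtain H :: nat where H: "inverse (real H) < (e / 2)\<^sup>2" "H > 0"
    using ex_inverse_of_nat_less[of "(e / 2)\<^sup>2"] by auto
  define b where "b = (\<lambda>n. (\<Sum>h<H. a (n + h)) / of_nat H)"
  have "(\<lambda>N. (\<Sum>h<H. average (\<lambda>n. a (n + h)) N - average a N) / of_nat H)
          \<longlonglongrightarrow> (\<Sum>h<H. 0) / of_nat H"
    using H unit by (intro tendsto_intros average_shift) (auto simp: less_imp_le)
  moreover have "(\<Sum>h<H. average (\<lambda>n. a (n + h)) N - average a N) / of_nat H
      = average b N - average a N" for N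
    using H unfolding b_def average_divide average_sum
    by (simp add: sum_subtractf diff_divide_distrib)
  ultimately have "(\<lambda>N. average b N - average a N) \<longlonglongrightarrow> 0"
    by simp
  then have near: "\<forall>\<^sub>F N in sequentially. norm (average b N - average a N) < e / 2"
    using \<open>e > 0\<close> by (auto simp: tendsto_iff dest: spec[where x = "e / 2"])
  have sq: "complex_of_real ((norm (b n))\<^sup>2)
      = (\<Sum>h<H. \<Sum>k<H. a (n + h) * cnj (a (n + k))) / of_nat (H * H)" for n
    unfolding complex_norm_square by (simp add: b_def sum_product)
  have "(\<lambda>N. (\<Sum>h<H. \<Sum>k<H. average (\<lambda>n. a (n + h) * cnj (a (n + k))) N) / of_nat (H * H))
      \<longlonglongrightarrow> (\<Sum>h<H. \<Sum>k<H. if h = k then 1 else 0) / of_nat (H * H)"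
    using H by (intro tendsto_intros pair) auto
  moreover have "(\<Sum>h<H. \<Sum>k<H. if h = k then 1 else 0) / of_nat (H * H)
      = complex_of_real (inverse (real H))"
    using H by (simp add: field_simps)
  ultimately have "(\<lambda>N. complex_of_real (average (\<lambda>n. (norm (b n))\<^sup>2) N))
      \<longlonglongrightarrow> complex_of_real (inverse (real H))"
    by (simp only: average_of_real[symmetric] sq average_divide average_sum)
  then have "average (\<lambda>n. (norm (b n))\<^sup>2) \<longlonglongrightarrow> inverse (real H)"
    by (simp only: tendsto_of_real_iff)
  then have "\<forall>\<^sub>F N in sequentially. average (\<lambda>n. (norm (b n))\<^sup>2) N < (e / 2)\<^sup>2"
    using H(1) by (rule order_tendstoD(2))
  with near show "\<forall>\<^sub>F N in sequentially. dist (average a N) 0 < e"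
  proof eventually_elim
    case (elim N)
    have "(norm (average b N))\<^sup>2 < (e / 2)\<^sup>2"
      using norm_average_power2_le[of b N] elim by simp
    then have "norm (average b N) < e / 2"
      by (rule power2_less_imp_less) (use \<open>e > 0\<close> in simp)
    moreover have "norm (average a N) \<le> norm (average b N) + norm (average b N - average a N)"
      by (metis norm_minus_commute norm_triangle_sub)
    ultimately show ?case
      using elim by simp
  qed
qed

section \<open>Quadratic exponential sums\<close>

abbreviation expi :: "real \<Rightarrow> complex" where
  "expi x \<equiv> cis (2 * pi * x)"

lemma average_expi_linear:
  assumes "x \<notin> \<int>"
  shows "average (\<lambda>n. expi (real n * x + y)) \<longlonglongrightarrow> 0"
proof -
  define w where "w = expi x"
  have w: "w \<noteq> 1"
  proof
    assume "w = 1"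
    then obtain k :: int where "2 * pi * x = of_int k * (2 * pi)"
      unfolding w_def cis_eq_1_iff by blast
    then have "x = of_int k"
      by simp
    with assms show False
      by simp
  qed
  have split: "expi (real n * x + y) = expi y * w ^ n" for n
    unfolding w_def Complex.DeMoivre cis_mult by (rule arg_cong[where f = cis]) (simp add: algebra_simps)
  have "average (\<lambda>n. w ^ n) \<longlonglongrightarrow> 0"
  proof (rule Lim_null_comparison)
    have "norm (average (\<lambda>n. w ^ n) N) \<le> (2 / norm (w - 1)) / real N" for N
    proof -
      have "norm (w ^ N - 1) \<le> 2"
        using norm_triangle_ineq4[of "w ^ N" 1] by (simp add: w_def norm_power)
      then have "norm (\<Sum>n<N. w ^ n) \<le> 2 / norm (w - 1)"
        by (simp add: geometric_sum[OF w] norm_divide divide_right_mono)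
      then show ?thesis
        by (simp add: average_def norm_divide divide_right_mono del: divide_divide_eq_left)
    qed
    then show "\<forall>\<^sub>F N in sequentially.
        norm (average (\<lambda>n. w ^ n) N) \<le> (2 / norm (w - 1)) / real N"
      by simp
    show "(\<lambda>N. (2 / norm (w - 1)) / real N) \<longlonglongrightarrow> 0"
      by (rule lim_const_over_n)
  qed
  then show ?thesis
    unfolding split average_mult_left by (rule tendsto_mult_right_zero)
qed

lemma of_int_mult_irrational_notin_Ints:
  fixes s :: real
  assumes "s \<notin> \<rat>" "k \<noteq> 0"
  shows "of_int k * s \<notin> \<int>"
proof
  assume "of_int k * s \<in> \<int>"
  then have "of_int k * s / of_int k \<in> \<rat>"
    by (intro Rats_divide) (auto elim!: Ints_cases)
  with assms show False
    by simp
qed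

text \<open>
  For \<open>q \<noteq> 0\<close> the quotient of the terms at \<open>n + h\<close> and \<open>n\<close> is a linear phase of slope \<open>q h s\<close>. The
  denominator 2 in \<open>n\<^sup>2 s / 2\<close> cancels against the 2 in \<open>2 n h\<close>, and the slope is irrational.
\<close>

lemma average_expi_quadratic:
  fixes s :: real and p q :: int
  assumes s: "s \<notin> \<rat>" and "p \<noteq> 0 \<or> q \<noteq> 0"
  shows "average (\<lambda>n. expi (of_int p * (real n * s) + of_int q * ((real n)\<^sup>2 * s / 2))) \<longlonglongrightarrow> 0"
proof (cases "q = 0")
  case True
  with assms average_expi_linear[of "of_int p * s" 0] show ?thesis
    by (simp add: of_int_mult_irrational_notin_Ints mult.left_commute)
next
  case False
  show ?thesis
  proof (rule van_der_Corput)
    fix h :: nat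
    assume "h > 0"
    with False have "of_int (q * int h) * s \<notin> \<int>"
      by (intro of_int_mult_irrational_notin_Ints s) simp
    from average_expi_linear[OF this, of "of_int p * real h * s + of_int q * (real h)\<^sup>2 * s / 2"]
    show "average (\<lambda>n.
        expi (of_int p * (real (n + h) * s) + of_int q * ((real (n + h))\<^sup>2 * s / 2))
        * cnj (expi (of_int p * (real n * s) + of_int q * ((real n)\<^sup>2 * s / 2)))) \<longlonglongrightarrow> 0"
      by (simp add: cis_cnj cis_mult power2_eq_square algebra_simps add_divide_distrib)
  qed simp
qed

section \<open>Density of a quadratic orbit on the torus\<close>

text \<open>
  The binomial expansion of \<open>(2 cos (\<pi> x))\<^sup>2\<^sup>K\<close>, written as a Fourier series: the index \<open>i = K\<close> gives
  the constant term.
\<close>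

lemma cos_power_fourier:
  "complex_of_real ((cos (pi * x))\<^sup>2 ^ K)
    = (\<Sum>i\<le>2 * K. of_real (real (2 * K choose i) / 4 ^ K) * expi (of_int (int i - int K) * x))"
proof -
  have cos: "complex_of_real (cos (pi * x)) = (cis (pi * x) + cis (- (pi * x))) / 2"
    by (simp add: complex_eq_iff)
  have "complex_of_real ((cos (pi * x))\<^sup>2 ^ K) = complex_of_real (cos (pi * x)) ^ (2 * K)"
    by (simp add: power_mult)
  also have "\<dots> = (cis (pi * x) + cis (- (pi * x))) ^ (2 * K) / 4 ^ K"
    unfolding cos power_divide by (simp add: power_mult[of "2::complex"])
  also have "\<dots> = (\<Sum>i\<le>2 * K. of_nat (2 * K choose i) * cis (pi * x) ^ i
      * cis (- (pi * x)) ^ (2 * K - i) / 4 ^ K)"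
    by (simp add: binomial_ring sum_divide_distrib)
  also have "\<dots> = (\<Sum>i\<le>2 * K. of_real (real (2 * K choose i) / 4 ^ K)
      * expi (of_int (int i - int K) * x))"
    by (rule sum.cong) (auto simp: Complex.DeMoivre cis_mult of_nat_diff algebra_simps)
  finally show ?thesis .
qed

text \<open>
  In the Fourier expansion of the kernel every non-constant term is, up to a constant phase coming from
  \<open>u\<close> and \<open>v\<close>, one of the quadratic exponentials whose averages vanish.
\<close>

lemma average_kernel:
  fixes s u v :: real and K :: nat
  assumes s: "s \<notin> \<rat>"
  shows "average (\<lambda>n. (cos (pi * (real n * s - u)))\<^sup>2 ^ K * (cos (pi * ((real n)\<^sup>2 * s / 2 - v)))\<^sup>2 ^ K)
    \<longlonglongrightarrow> (real (2 * K choose K) / 4 ^ K)\<^sup>2"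
proof -
  define c where "c i = complex_of_real (real (2 * K choose i) / 4 ^ K)" for i
  define d where "d i j = c i * c j * expi (- of_int (int i - int K) * u - of_int (int j - int K) * v)"
    for i j
  define E where "E i j n = expi (of_int (int i - int K) * (real n * s)
      + of_int (int j - int K) * ((real n)\<^sup>2 * s / 2))" for i j n
  have coeff: "c i * expi (of_int (int i - int K) * (real n * s - u))
      * (c j * expi (of_int (int j - int K) * ((real n)\<^sup>2 * s / 2 - v))) = d i j * E i j n" for i j n
  proof -
    have "expi (of_int (int i - int K) * (real n * s - u))
        * expi (of_int (int j - int K) * ((real n)\<^sup>2 * s / 2 - v))
      = expi (- of_int (int i - int K) * u - of_int (int j - int K) * v) * E i j n"
      unfolding E_def cis_mult by (rule arg_cong[where f = cis]) (simp add: algebra_simps)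
    then show ?thesis
      by (simp add: d_def mult_ac)
  qed
  have expand: "complex_of_real ((cos (pi * (real n * s - u)))\<^sup>2 ^ K
      * (cos (pi * ((real n)\<^sup>2 * s / 2 - v)))\<^sup>2 ^ K) = (\<Sum>i\<le>2 * K. \<Sum>j\<le>2 * K. d i j * E i j n)" for n
    unfolding of_real_mult cos_power_fourier sum_product c_def[symmetric] coeff ..
  have E: "average (E i j) \<longlonglongrightarrow> (if i = K \<and> j = K then 1 else 0)" for i j
  proof (cases "i = K \<and> j = K")
    case True
    then have "E i j = (\<lambda>n. 1)"
      by (auto simp: E_def)
    with True average_const show ?thesis
      by simp
  next
    case False
    then have "int i - int K \<noteq> 0 \<or> int j - int K \<noteq> 0"
      by auto
    from average_expi_quadratic[OF s this] False show ?thesis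
      unfolding E_def by (simp add: if_not_P)
  qed
  have "(\<lambda>N. \<Sum>i\<le>2 * K. \<Sum>j\<le>2 * K. d i j * average (E i j) N)
      \<longlonglongrightarrow> (\<Sum>i\<le>2 * K. \<Sum>j\<le>2 * K. d i j * (if i = K \<and> j = K then 1 else 0))"
    by (intro tendsto_intros E)
  also have "(\<Sum>i\<le>2 * K. \<Sum>j\<le>2 * K. d i j * (if i = K \<and> j = K then 1 else 0))
      = (\<Sum>i\<le>2 * K. \<Sum>j\<le>2 * K. if j = K then if i = K then d i j else 0 else 0)"
    by (intro sum.cong) auto
  also have "\<dots> = complex_of_real ((real (2 * K choose K) / 4 ^ K)\<^sup>2)"
    by (simp add: d_def c_def power2_eq_square)
  finally have "(\<lambda>N. complex_of_real (average (\<lambda>n. (cos (pi * (real n * s - u)))\<^sup>2 ^ K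
      * (cos (pi * ((real n)\<^sup>2 * s / 2 - v)))\<^sup>2 ^ K) N))
      \<longlonglongrightarrow> complex_of_real ((real (2 * K choose K) / 4 ^ K)\<^sup>2)"
    by (simp only: average_of_real[symmetric] expand average_sum average_mult_left)
  then show ?thesis
    by (simp only: tendsto_of_real_iff)
qed

text \<open>
  If the claim failed, one of the two factors of the kernel would be at most \<open>\<eta>\<^sup>K\<close> from time \<open>M\<close> on, hence so
  would be the limit average. The central binomial coefficient bounds that average
  below by \<open>1 / (4 K\<^sup>2)\<close>, which is impossible for large \<open>K\<close>.
\<close>

lemma quadratic_orbit_cos_near_1:
  fixes s u v \<eta> :: real
  assumes s: "s \<notin> \<rat>" and \<eta>: "0 \<le> \<eta>" "\<eta> < 1"
  shows "\<exists>n\<ge>M. (cos (pi * (real n * s - u)))\<^sup>2 > \<eta> \<and> (cos (pi * ((real n)\<^sup>2 * s / 2 - v)))\<^sup>2 > \<eta>"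
proof (rule ccontr)
  assume miss: "\<not> ?thesis"
  define f where "f K n = (cos (pi * (real n * s - u)))\<^sup>2 ^ K
      * (cos (pi * ((real n)\<^sup>2 * s / 2 - v)))\<^sup>2 ^ K" for K n
  have cos_le: "(cos x)\<^sup>2 ^ K \<le> 1" for x :: real and K
    by (rule power_le_one) (auto simp: abs_square_le_1)
  have upper: "(real (2 * K choose K) / 4 ^ K)\<^sup>2 \<le> \<eta> ^ K" for K
  proof -
    have "norm (f K n) \<le> 1" for n
      unfolding f_def by (simp add: abs_mult mult_le_one cos_le del: power_mult)
    from average_shift[of "f K", OF this, of M]
    have "(\<lambda>N. average (\<lambda>n. f K (n + M)) N - average (f K) N) \<longlonglongrightarrow> 0" .
    moreover have "average (f K) \<longlonglongrightarrow> (real (2 * K choose K) / 4 ^ K)\<^sup>2"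
      unfolding f_def by (rule average_kernel[OF s])
    ultimately have lim: "average (\<lambda>n. f K (n + M)) \<longlonglongrightarrow> (real (2 * K choose K) / 4 ^ K)\<^sup>2"
      using Lim_transform by blast
    have le: "f K (n + M) \<le> \<eta> ^ K" for n
    proof -
      have "(cos (pi * (real (n + M) * s - u)))\<^sup>2 \<le> \<eta> \<or>
          (cos (pi * ((real (n + M))\<^sup>2 * s / 2 - v)))\<^sup>2 \<le> \<eta>"
        using miss by (meson le_add2 not_less)
      then show ?thesis
      proof
        assume "(cos (pi * (real (n + M) * s - u)))\<^sup>2 \<le> \<eta>"
        then have "f K (n + M) \<le> \<eta> ^ K * 1"
          unfolding f_def by (intro mult_mono cos_le power_mono) (use \<eta> in auto)
        then show ?thesis by simp
      next
        assume "(cos (pi * ((real (n + M))\<^sup>2 * s / 2 - v)))\<^sup>2 \<le> \<eta>"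
        then have "f K (n + M) \<le> 1 * \<eta> ^ K"
          unfolding f_def by (intro mult_mono cos_le power_mono) (use \<eta> in auto)
        then show ?thesis by simp
      qed
    qed
    have "average (\<lambda>n. f K (n + M)) N \<le> \<eta> ^ K" for N
    proof -
      have "(\<Sum>n<N. f K (n + M)) \<le> (\<Sum>n<N. \<eta> ^ K)"
        by (intro sum_mono le)
      then show ?thesis
        using \<eta> by (cases "N = 0") (simp_all add: average_def field_simps)
    qed
    with lim show ?thesis
      by (intro LIMSEQ_le_const2[OF lim]) auto
  qed
  have lower: "1 / (4 * (real K)\<^sup>2) \<le> (real (2 * K choose K) / 4 ^ K)\<^sup>2" if "K > 0" for K
  proof -
    have "1 / (2 * real K) \<le> real (2 * K choose K) / 4 ^ K"
      using central_binomial_lower_bound[OF that] that by (simp add: field_simps)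
    then have "(1 / (2 * real K))\<^sup>2 \<le> (real (2 * K choose K) / 4 ^ K)\<^sup>2"
      by (intro power_mono) auto
    then show ?thesis
      by (simp add: power_divide power_mult_distrib)
  qed
  have "(\<lambda>K. (real K * sqrt \<eta> ^ K)\<^sup>2) \<longlonglongrightarrow> 0\<^sup>2"
    using \<eta> by (intro tendsto_power powser_times_n_limit_0) simp
  moreover have "(sqrt \<eta> ^ K)\<^sup>2 = \<eta> ^ K" for K
    by (metis \<eta>(1) mult.commute power_mult real_sqrt_pow2)
  then have "(real K * sqrt \<eta> ^ K)\<^sup>2 = real K ^ 2 * \<eta> ^ K" for K
    by (simp add: power_mult_distrib)
  ultimately have "(\<lambda>K. real K ^ 2 * \<eta> ^ K) \<longlonglongrightarrow> 0"
    by simp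
  then have "\<forall>\<^sub>F K in sequentially. real K ^ 2 * \<eta> ^ K < 1 / 4"
    by (rule order_tendstoD) simp
  then have "\<forall>\<^sub>F K in sequentially. K > 0 \<and> real K ^ 2 * \<eta> ^ K < 1 / 4"
    using eventually_gt_at_top[of 0] by eventually_elim simp
  then obtain K where K: "K > 0" "real K ^ 2 * \<eta> ^ K < 1 / 4"
    using eventually_happens'[OF sequentially_bot] by blast
  have "1 / (4 * (real K)\<^sup>2) \<le> \<eta> ^ K"
    using lower[OF K(1)] upper[of K] by linarith
  with K show False
    by (simp add: field_simps)
qed

text \<open>
  Hypothesis and conclusion depend on \<open>x\<close> only through its distance to the nearest integer, which is at most \<open>1 / 2\<close>, and
  there \<open>cos (\<pi> d)\<close> is non-negative and decreasing.
\<close>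

lemma near_int_if_cos_near_1:
  fixes x \<epsilon> :: real
  assumes \<epsilon>: "0 < \<epsilon>" "\<epsilon> < 1 / 2" and cos: "(cos (pi * x))\<^sup>2 > (cos (pi * \<epsilon>))\<^sup>2"
  shows "\<bar>x - of_int (round x)\<bar> < \<epsilon>"
proof (rule ccontr)
  define d where "d = \<bar>x - of_int (round x)\<bar>"
  assume "\<not> ?thesis"
  then have d: "\<epsilon> \<le> d" "d \<le> 1 / 2"
    using of_int_round_abs_le[of x] by (auto simp: d_def abs_minus_commute)
  have "\<bar>cos (pi * x)\<bar> = \<bar>cos (pi * (x - of_int (round x)))\<bar>"
    by (simp add: right_diff_distrib cos_diff abs_mult)
  also have "\<dots> = \<bar>cos (pi * d)\<bar>"
    using cos_abs_real[of "pi * (x - of_int (round x))"] by (simp add: d_def abs_mult)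
  also have "\<dots> = cos (pi * d)"
    using d \<epsilon> by (intro abs_of_nonneg cos_ge_zero) (auto simp: field_simps intro: order.trans[of _ 0])
  also have "\<dots> \<le> cos (pi * \<epsilon>)"
    using d \<epsilon> by (intro cos_monotone_0_pi_le) (auto simp: field_simps)
  finally have "\<bar>cos (pi * x)\<bar>\<^sup>2 \<le> (cos (pi * \<epsilon>))\<^sup>2"
    by (intro power_mono) auto
  with cos show False
    by simp
qed

lemma quadratic_orbit_dense:
  fixes s u v \<epsilon> :: real
  assumes s: "s \<notin> \<rat>" and "\<epsilon> > 0"
  obtains n :: nat and j k :: int
  where "n \<ge> M" "\<bar>real n * s - u - of_int j\<bar> < \<epsilon>" "\<bar>(real n)\<^sup>2 * s / 2 - v - of_int k\<bar> < \<epsilon>"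
proof -
  \<comment> \<open>On distances up to \<open>1 / 2\<close> the squared cosine is decreasing, so the tolerance is capped below that.\<close>
  define \<delta> where "\<delta> = min \<epsilon> (1 / 4)"
  have \<delta>: "0 < \<delta>" "\<delta> < 1 / 2" "\<delta> \<le> \<epsilon>"
    using \<open>\<epsilon> > 0\<close> by (auto simp: \<delta>_def)
  have "0 < pi * \<delta>" "pi * \<delta> < pi"
    using \<delta> by auto
  then have "cos (pi * \<delta>) < 1"
    using cos_monotone_0_pi[of 0 "pi * \<delta>"] by simp
  moreover have "0 \<le> cos (pi * \<delta>)"
    using \<delta> by (intro cos_ge_zero) (auto simp: field_simps intro: order.trans[of _ 0])
  ultimately have "(cos (pi * \<delta>))\<^sup>2 < 1"
    by (simp add: power_less_one_iff abs_square_less_1)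
  from quadratic_orbit_cos_near_1[OF s _ this, of M u v]
  obtain n where n: "n \<ge> M" "(cos (pi * (real n * s - u)))\<^sup>2 > (cos (pi * \<delta>))\<^sup>2"
      "(cos (pi * ((real n)\<^sup>2 * s / 2 - v)))\<^sup>2 > (cos (pi * \<delta>))\<^sup>2"
    by auto
  show ?thesis
    using that[OF n(1)] near_int_if_cos_near_1[OF \<delta>(1,2) n(2)]
      near_int_if_cos_near_1[OF \<delta>(1,2) n(3)] \<delta>(3) by (meson less_le_trans)
qed

section \<open>The curve in the nil-manifold\<close>

text \<open>The coordinates enter the matrix affinely.\<close>

lemma continuous_on_heis: "continuous_on UNIV (\<lambda>(a, b, c). heis a b c)"
proof -
  have "(\<lambda>(a, b, c). heis a b c) = (\<lambda>(a, b, c). mat 1 + a *\<^sub>R (heis 1 0 0 - mat 1) + b *\<^sub>R (heis 0 1 0 - mat 1)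
      + c *\<^sub>R (heis 0 0 1 - mat 1))"
    by (simp add: fun_eq_iff heis_def vec_eq_iff forall_3 mat_def)
  then show ?thesis
    unfolding case_prod_beta by (simp only:) (intro continuous_intros)
qed

lemma heis_proj_mult_int:
  assumes "a \<in> \<int>" "b \<in> \<int>" "c \<in> \<int>"
  shows "heis_proj (heis a b c ** heis x y z) = heis_proj (heis x y z)"
proof -
  interpret group heis_group
    by (rule group_heis_group)
  have sub: "heis_int \<subseteq> carrier heis_group"
    by (rule subgroup.subset[OF subgroup_heis_int])
  have h: "heis a b c \<in> heis_int"
    using assms by (auto simp: heis_int_def)
  have g: "heis x y z \<in> carrier heis_group"
    by (auto simp: heis_group_def)
  have "heis_int #>\<^bsub>heis_group\<^esub> (heis a b c \<otimes>\<^bsub>heis_group\<^esub> heis x y z)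
      = heis_int #>\<^bsub>heis_group\<^esub> heis x y z"
    using coset_mult_assoc[OF sub _ g, of "heis a b c"] coset_join2[OF _ subgroup_heis_int h] h sub
    by auto
  then show ?thesis
    by (simp add: heis_proj_def heis_group_def)
qed

lemma nil_curve_in_topspace: "nil_curve \<theta> t \<in> topspace heis_nilmanifold"
  by (auto simp: nil_curve_def heis_nilmanifold_def heis_curve_def heis_group_def)

text \<open>
  Density in the quotient can be tested in the coordinates: an open set pulls back to an open set of
  triples, and a point of the curve may be represented by any element of its coset.
\<close>

lemma dense_in_nilmanifoldI:
  assumes approx: "\<And>x y z \<epsilon>. \<epsilon> > 0 \<Longrightarrow> \<exists>t\<in>T. \<exists>x' y' z'. nil_curve \<theta> t = heis_proj (heis x' y' z')
      \<and> \<bar>x' - x\<bar> < \<epsilon> \<and> \<bar>y' - y\<bar> < \<epsilon> \<and> \<bar>z' - z\<bar> < \<epsilon>"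
  shows "dense_in heis_nilmanifold (nil_curve \<theta> ` T)"
  unfolding dense_in_def
proof (intro conjI subset_antisym closure_of_subset_topspace subsetI)
  show "p \<in> topspace heis_nilmanifold" if "p \<in> nil_curve \<theta> ` T" for p
    using that nil_curve_in_topspace by auto
next
  fix p
  assume p: "p \<in> topspace heis_nilmanifold"
  then obtain x y z where xyz: "p = heis_proj (heis x y z)"
    by (auto simp: heis_nilmanifold_def heis_group_def)
  have "\<exists>q. q \<in> nil_curve \<theta> ` T \<and> q \<in> V" if V: "p \<in> V" "openin heis_nilmanifold V" for V
  proof -
    obtain W where W: "open W"
        "{g \<in> carrier heis_group. heis_proj g \<in> V} = carrier heis_group \<inter> W"
      using V(2) by (auto simp: heis_nilmanifold_def openin_quotient_topology openin_open)
    have in_W: "heis a b c \<in> W \<longleftrightarrow> heis_proj (heis a b c) \<in> V" for a b c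
      using W(2) by (auto simp: heis_group_def)
    define U where "U = (\<lambda>(a, b, c). heis a b c) -` W"
    have "open U"
      unfolding U_def by (rule open_vimage[OF W(1) continuous_on_heis])
    moreover have "(x, y, z) \<in> U"
      using V(1) by (simp add: U_def in_W xyz)
    ultimately obtain \<epsilon> where \<epsilon>: "\<epsilon> > 0" "\<And>w. dist w (x, y, z) < \<epsilon> \<Longrightarrow> w \<in> U"
      by (meson open_dist)
    obtain t x' y' z' where t: "t \<in> T" "nil_curve \<theta> t = heis_proj (heis x' y' z')"
        "\<bar>x' - x\<bar> < \<epsilon> / 3" "\<bar>y' - y\<bar> < \<epsilon> / 3" "\<bar>z' - z\<bar> < \<epsilon> / 3"
      using approx[of "\<epsilon> / 3" x y z] \<epsilon>(1) by auto
    have "dist (x', y', z') (x, y, z) \<le> dist x' x + dist (y', z') (y, z)"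
      unfolding dist_Pair_Pair[of x'] by (rule sqrt_sum_squares_le_sum) auto
    also have "\<dots> \<le> dist x' x + (dist y' y + dist z' z)"
      by (simp add: dist_Pair_Pair sqrt_sum_squares_le_sum)
    finally have "(x', y', z') \<in> U"
      using t by (intro \<epsilon>(2)) (simp add: dist_real_def)
    then show ?thesis
      using t(1) imageI[OF t(1), of "nil_curve \<theta>"]
      by (intro exI[of _ "nil_curve \<theta> t"]) (simp add: U_def in_W t(2))
  qed
  with p show "p \<in> heis_nilmanifold closure_of nil_curve \<theta> ` T"
    by (auto simp: in_closure_of)
qed

text \<open>
  The representative with first coordinate exactly \<open>x\<close>, obtained by multiplying with \<open>(m, n, k)\<close>. The
  cross term \<open>m (x - m) s\<close> of the group law combines with \<open>(x - m)\<^sup>2 s / 2\<close> to \<open>(x\<^sup>2 - m\<^sup>2) s / 2\<close>, so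
  that \<open>x\<close> and \<open>m\<close> separate.
\<close>

lemma nil_curve_return:
  assumes "cos \<theta> \<noteq> 0" "m \<in> \<int>" "n \<in> \<int>" "k \<in> \<int>"
  shows "nil_curve \<theta> ((x - m) / cos \<theta>)
    = heis_proj (heis x (n + (x - m) * tan \<theta>) (k + (x\<^sup>2 - m\<^sup>2) * tan \<theta> / 2))"
proof -
  define t where "t = (x - m) / cos \<theta>"
  have t: "t * cos \<theta> = x - m" "t * sin \<theta> = (x - m) * tan \<theta>"
    using assms(1) by (simp_all add: t_def tan_def)
  have "t\<^sup>2 / 2 * sin \<theta> * cos \<theta> = (t * sin \<theta>) * (t * cos \<theta>) / 2"
    by (simp add: power2_eq_square)
  also have "\<dots> = (x - m)\<^sup>2 * tan \<theta> / 2"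
    unfolding t by (simp add: power2_eq_square)
  finally have "heis m n k ** heis_curve \<theta> t
      = heis x (n + (x - m) * tan \<theta>) (k + (x\<^sup>2 - m\<^sup>2) * tan \<theta> / 2)"
    unfolding heis_curve_def heis_mult t by (simp add: power2_eq_square field_simps)
  then show ?thesis
    unfolding nil_curve_def t_def[symmetric] using heis_proj_mult_int[OF assms(2-4)]
    by (metis heis_curve_def)
qed

text \<open>
  The sign \<open>\<sigma>\<close> selects a half in terms of the first coordinate \<open>t cos \<theta>\<close> of the curve, which treats both signs of
  \<open>cos \<theta>\<close> alike. Taking \<open>m = - \<sigma> n\<close> with \<open>n > \<bar>x\<bar>\<close> puts the crossing into that half. Since \<open>m\<^sup>2 = n\<^sup>2\<close>,
  the sign affects only the linear condition, where it is absorbed into the target.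
\<close>

lemma dense_in_nilmanifold_half:
  fixes \<sigma> :: real
  assumes "cos \<theta> \<noteq> 0" "tan \<theta> \<notin> \<rat>" and \<sigma>: "\<sigma> = 1 \<or> \<sigma> = -1"
  shows "dense_in heis_nilmanifold (nil_curve \<theta> ` {t. \<sigma> * (t * cos \<theta>) > 0})"
proof (rule dense_in_nilmanifoldI)
  fix x y z \<epsilon> :: real
  assume "\<epsilon> > 0"
  define s where "s = tan \<theta>"
  obtain n :: nat and j k :: int where n: "n \<ge> nat \<lceil>\<bar>x\<bar>\<rceil> + 1"
    and j: "\<bar>real n * s - \<sigma> * (y - x * s) - of_int j\<bar> < \<epsilon>"
    and k: "\<bar>(real n)\<^sup>2 * s / 2 - (x\<^sup>2 * s / 2 - z) - of_int k\<bar> < \<epsilon>"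
    using quadratic_orbit_dense[OF assms(2) \<open>\<epsilon> > 0\<close>] unfolding s_def by metis
  define m where "m = - \<sigma> * real n"
  have m: "m \<in> \<int>" "\<sigma> * of_int j \<in> \<int>" "m\<^sup>2 = (real n)\<^sup>2"
    using \<sigma> by (auto simp: m_def)
  have curve: "nil_curve \<theta> ((x - m) / cos \<theta>)
      = heis_proj (heis x (- \<sigma> * of_int j + (x - m) * s) (of_int k + (x\<^sup>2 - m\<^sup>2) * s / 2))"
    unfolding s_def using m by (intro nil_curve_return assms(1)) auto
  have "\<bar>x\<bar> < real n"
    using n by linarith
  then have pos: "\<sigma> * (x - m) > 0"
    using \<sigma> by (auto simp: m_def)
  have "\<bar>- \<sigma> * of_int j + (x - m) * s - y\<bar> = \<bar>real n * s - \<sigma> * (y - x * s) - of_int j\<bar>"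
    using \<sigma> by (auto simp: m_def algebra_simps abs_if)
  moreover have "\<bar>of_int k + (x\<^sup>2 - m\<^sup>2) * s / 2 - z\<bar>
      = \<bar>(real n)\<^sup>2 * s / 2 - (x\<^sup>2 * s / 2 - z) - of_int k\<bar>"
    unfolding m by (simp add: field_simps abs_if)
  ultimately show "\<exists>t\<in>{t. \<sigma> * (t * cos \<theta>) > 0}. \<exists>x' y' z'. nil_curve \<theta> t = heis_proj (heis x' y' z')
      \<and> \<bar>x' - x\<bar> < \<epsilon> \<and> \<bar>y' - y\<bar> < \<epsilon> \<and> \<bar>z' - z\<bar> < \<epsilon>"
    using curve j k pos assms(1) \<open>\<epsilon> > 0\<close>
    by (intro bexI[of _ "(x - m) / cos \<theta>"] exI conjI) auto
qed

lemma dense_in_mono: "dense_in X S \<Longrightarrow> S \<subseteq> S' \<Longrightarrow> S' \<subseteq> topspace X \<Longrightarrow> dense_in X S'"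
  unfolding dense_in_def by (metis closure_of_mono closure_of_subset_topspace subset_antisym)

theorem theorem5p3:
  fixes \<theta> :: real
  assumes "cos \<theta> \<noteq> 0" and "tan \<theta> \<notin> \<rat>"
  shows "dense_in heis_nilmanifold (range (nil_curve \<theta>)) \<and>
         dense_in heis_nilmanifold (nil_curve \<theta> ` {0<..}) \<and>
         dense_in heis_nilmanifold (nil_curve \<theta> ` {..<0})"
proof -
  define \<sigma> where "\<sigma> = sgn (cos \<theta>)"
  have \<sigma>: "\<sigma> = 1 \<or> \<sigma> = -1" "- \<sigma> = 1 \<or> - \<sigma> = -1"
    using assms(1) by (auto simp: \<sigma>_def sgn_if)
  have "\<sigma> * (t * cos \<theta>) > 0 \<longleftrightarrow> t > 0" "- \<sigma> * (t * cos \<theta>) > 0 \<longleftrightarrow> t < 0" for t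
    using assms(1) by (auto simp: \<sigma>_def sgn_if zero_less_mult_iff mult_less_0_iff)
  with dense_in_nilmanifold_half[OF assms \<sigma>(1)] dense_in_nilmanifold_half[OF assms \<sigma>(2)]
  have half: "dense_in heis_nilmanifold (nil_curve \<theta> ` {0<..})"
      "dense_in heis_nilmanifold (nil_curve \<theta> ` {..<0})"
    by (simp_all only: greaterThan_def lessThan_def)
  have "dense_in heis_nilmanifold (range (nil_curve \<theta>))"
    by (rule dense_in_mono[OF half(1)]) (use nil_curve_in_topspace in auto)
  with half show ?thesis
    by blast
qed

end
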